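(* Let $Q=\bigwedge_{e\in\mathcal E}R_e(e)$ be any Boolean conjunctive query with intersection joins, with hypergraph $\mathcal H=(\mathcal V,\mathcal E)$, and let $\mathbf D$ be any database of intervals over the schema of $Q$. Let $\tilde{\mathbf Q}$ be the set of Boolean conjunctive queries with equality joins, and $\tilde{\mathbf D}$ the database of bitstrings, produced from $(\mathcal H,Q,\mathbf D)$ by the forward reduction described in the context. Then $Q(\mathbf D)$ is true if and only if $\bigvee_{\tilde Q\in\tilde{\mathbf Q}}\tilde Q(\tilde{\mathbf D})$ is true.
   Context: Hypergraphs and queries. A (multi-)hypergraph $\mathcal H=(\mathcal V,\mathcal E)$ has a finite set $\mathcal V$ of vertices and a finite multiset $\mathcal E$ of non-empty subsets of $\mathcal V$ (hyperedges), which are labelled so that equal hyperedges are distinguishable. $\mathcal E_X$ is the set of (labelled) hyperedges containing $X$. A Boolean conjunctive query with intersection joins (IJ query) over $\mathcal H$ is $Q=\bigwedge_{e\in\mathcal E}R_e(e)$, where the vertices are interval variables $[X]$; a database $\mathbf D$ gives for each $e\in\mathcal E$ a finite relation $R_e$ whose tuples map each $[X]\in e$ to an interval. $Q(\mathbf D)$ is true iff there are tuples $(t_e)_{e\in\mathcal E}\in\prod_e R_e$ such that $\bigcap_{e\in\mathcal E_{[X]}}t_e([X])\neq\emptyset$ for every $[X]\in\mathcal V$. A Boolean conjunctive query with equality joins (EJ query) has the same form with point variables; it is true iff there are tuples $t_e\in R_e$ such that for every variable $X$ the value $t_e(X)$ is the same for all $e\in\mathcal E_X$. Here values of point variables are bitstrings.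 Segment tree. All intervals are closed intervals $[l,r]$ with real $l\le r$. For a finite set $\mathcal I$ of intervals let $p_1<\dots<p_m$ be the distinct endpoints. The elementary segments are $(-\infty,p_1),[p_1,p_1],(p_1,p_2),[p_2,p_2],\dots,(p_{m-1},p_m),[p_m,p_m],(p_m,+\infty)$. The segment tree $\mathfrak T_{\mathcal I}$ is the complete binary tree (every level except possibly the last is full, last-level nodes are as far left as possible, every node has 0 or 2 children) whose leaves, left to right, correspond to the elementary segments; $\mathrm{seg}(v)$ is the union of the elementary segments at the leaves below $v$. Each node is identified with a bitstring: the root is the empty string, and the left/right child of $b$ is $b\circ 0$ / $b\circ 1$ ($\circ$ is concatenation). For $x\in\mathcal I$, the canonical partition is $\mathrm{CP}_{\mathcal I}(x)=\{v:\mathrm{seg}(v)\subseteq x,\ \mathrm{seg}(\mathrm{parent}(v))\not\subseteq x\}$ (the second condition is void for the root), and $\mathrm{leaf}(x)$ is the leaf whose segment contains the left endpoint of $x$. Forward reduction. For each $[X]\in\mathcal V$ put $k_X=|\mathcal E_{[X]}|$, let $\mathcal I_X$ be the set of all $[X]$-values occurring in the relations $R_e$, $e\in\mathcal E_{[X]}$, and introduce fresh point variables $X_1,\dots,X_{k_X}$. For a choice $\boldsymbol\sigma=(\sigma^X)_{[X]\in\mathcal V}$ of one permutation $\sigma^X=(\sigma^X_1,\dots,\sigma^X_{k_X})$ of $\mathcal E_{[X]}$ for each $[X]$, let $p_X(e)$ be the position of $e$ in $\sigma^X$, i.e. $\sigma^X_{p_X(e)}=e$. The hypergraph $\tilde{\mathcal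 H}_{\boldsymbol\sigma}$ has vertices $\bigcup_{[X]\in\mathcal V}\{X_1,\dots,X_{k_X}\}$ and, for each $e\in\mathcal E$, the hyperedge $\tilde e_{\boldsymbol\sigma}=\bigcup_{[X]\in e}\{X_1,\dots,X_{p_X(e)}\}$. The EJ query $\tilde Q_{\boldsymbol\sigma}$ is $\bigwedge_{e\in\mathcal E}\tilde R_{e,\boldsymbol\sigma}(\tilde e_{\boldsymbol\sigma})$, and $\tilde{\mathbf Q}$ is the set of all $\tilde Q_{\boldsymbol\sigma}$. The database $\tilde{\mathbf D}$ consists of all relations $\tilde R_{e,\boldsymbol\sigma}$, where $\tilde R_{e,\boldsymbol\sigma}$ (it depends only on $e$ and the positions $(p_X(e))_{[X]\in e}$) contains exactly the tuples $\tilde t$ over $\tilde e_{\boldsymbol\sigma}$ for which there is $t\in R_e$ such that for every $[X]\in e$, with $i=p_X(e)$: $\tilde t(X_1)\circ\cdots\circ\tilde t(X_i)\in\mathrm{CP}_{\mathcal I_X}(t([X]))$ if $i<k_X$, and $\tilde t(X_1)\circ\cdots\circ\tilde t(X_i)=\mathrm{leaf}(t([X]))$ (in $\mathfrak T_{\mathcal I_X}$) if $i=k_X$. (The bitstrings $\tilde t(X_j)$ may be empty.) *)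

theory Defs
  imports
    "HOL-Library.FuncSet"
    "HOL-Library.Sublist"
    "HOL-Library.Interval"
    "HOL-Combinatorics.Multiset_Permutations"
begin

section \<open>Hypergraphs and Boolean conjunctive queries\<close>

text \<open>
  Hyperedges are given by labels, so that distinct labels may carry the same set of vertices.
  A Boolean conjunctive query is identified with its hypergraph: the label \<open>e\<close> is also the
  relation symbol of the atom over the variables \<open>ends H e\<close>.  A tuple over a set \<open>A\<close> of variables
  is an element of \<open>A \<rightarrow>\<^sub>E UNIV\<close>, and a database maps every relation symbol to a set of tuples.
\<close>

record ('v, 'e) hypergraph =
  verts :: "'v set"
  edges :: "'e set"
  ends :: "'e \<Rightarrow> 'v set"

definition hypergraph :: "('v, 'e) hypergraph \<Rightarrow> bool" where
  "hypergraph H \<longleftrightarrow> finite (verts H) \<and> finite (edges H) \<and>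
     (\<forall>e\<in>edges H. ends H e \<noteq> {} \<and> ends H e \<subseteq> verts H)"

definition edges_at :: "('v, 'e) hypergraph \<Rightarrow> 'v \<Rightarrow> 'e set" where
  "edges_at H X = {e \<in> edges H. X \<in> ends H e}"

type_synonym ('r, 'v, 'a) database = "'r \<Rightarrow> ('v \<Rightarrow> 'a) set"

definition database_over :: "('v, 'e) hypergraph \<Rightarrow> ('e, 'v, 'a) database \<Rightarrow> bool" where
  "database_over H D \<longleftrightarrow> (\<forall>e\<in>edges H. finite (D e) \<and> D e \<subseteq> (ends H e \<rightarrow>\<^sub>E UNIV))"

text \<open>
  If no hyperedge contains \<open>X\<close>, the intersection in \<open>ij_true\<close> is \<open>UNIV\<close>: an isolated
  vertex imposes no condition.
\<close>

definition ij_true :: "('v, 'e) hypergraph \<Rightarrow> ('e, 'v, real interval) database \<Rightarrow> bool" where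
  "ij_true H D \<longleftrightarrow>
     (\<exists>t \<in> (\<Pi>\<^sub>E e\<in>edges H. D e). \<forall>X\<in>verts H. (\<Inter>e\<in>edges_at H X. set_of (t e X)) \<noteq> {})"

definition ej_true :: "('v, 'e) hypergraph \<Rightarrow> ('e, 'v, 'a) database \<Rightarrow> bool" where
  "ej_true H D \<longleftrightarrow>
     (\<exists>t \<in> (\<Pi>\<^sub>E e\<in>edges H. D e).
        \<forall>X\<in>verts H. \<forall>e\<in>edges_at H X. \<forall>f\<in>edges_at H X. t e X = t f X)"


section \<open>Complete binary trees\<close>

text \<open>
  A binary tree is the set of its nodes; a node is a bitstring, with \<open>False\<close> for the bit 0 (left)
  and \<open>True\<close> for the bit 1 (right).
\<close>

type_synonym bits = "bool list"

text \<open>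
  \<open>lexord\<close> also puts a bitstring before its proper extensions; \<open>left_of\<close> is only used for nodes
  of one level and for leaves of one tree, where neither is a proper prefix of the other.
\<close>

definition left_of :: "bits \<Rightarrow> bits \<Rightarrow> bool" where
  "left_of b c \<longleftrightarrow> (b, c) \<in> lexord {(False, True)}"

definition leaves :: "bits set \<Rightarrow> bits set" where
  "leaves N = {b \<in> N. \<forall>x. b @ [x] \<notin> N}"

definition binary_tree :: "bits set \<Rightarrow> bool" where
  "binary_tree N \<longleftrightarrow> finite N \<and> [] \<in> N \<and> (\<forall>b x. b @ [x] \<in> N \<longrightarrow> b \<in> N)"

text \<open>
  The conjuncts say: every node has 0 or 2 children; every level above a nonempty level is full;
  the nodes of a level are as far left as possible.
\<close>

definition complete_binary_tree :: "bits set \<Rightarrow> bool" where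
  "complete_binary_tree N \<longleftrightarrow> binary_tree N \<and>
     (\<forall>b\<in>N. b @ [False] \<in> N \<longleftrightarrow> b @ [True] \<in> N) \<and>
     (\<forall>b\<in>N. \<forall>c. length c < length b \<longrightarrow> c \<in> N) \<and>
     (\<forall>b\<in>N. \<forall>c. length c = length b \<and> left_of c b \<longrightarrow> c \<in> N)"

definition complete_tree :: "nat \<Rightarrow> bits set" where
  "complete_tree n = (THE N. complete_binary_tree N \<and> card (leaves N) = n)"


subsection \<open>Existence and uniqueness for every positive number of leaves\<close>

definition heap_index :: "bits \<Rightarrow> nat" where
  "heap_index b = foldl (\<lambda>i x. 2 * i + of_bool x) 1 b"

lemma heap_index_Nil [simp]: "heap_index [] = 1"
  by (simp add: heap_index_def)

lemma heap_index_snoc [simp]: "heap_index (b @ [x]) = 2 * heap_index b + of_bool x"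
  by (simp add: heap_index_def)

lemma heap_index_bounds: "2 ^ length b \<le> heap_index b \<and> heap_index b < 2 * 2 ^ length b"
  by (induction b rule: rev_induct) auto

lemma heap_index_pos: "heap_index b \<ge> 1"
  using heap_index_bounds[of b] by (meson le_trans one_le_numeral one_le_power)

lemma heap_index_append: "heap_index (p @ q) = foldl (\<lambda>i x. 2 * i + of_bool x) (heap_index p) q"
  by (simp add: heap_index_def)

lemma foldl_bounds:
  fixes i :: nat
  shows "i * 2 ^ length q \<le> foldl (\<lambda>i x. 2 * i + of_bool x) i q \<and>
         foldl (\<lambda>i x. 2 * i + of_bool x) i q < (i + 1) * 2 ^ length q"
  by (induction q rule: rev_induct) auto

lemma heap_index_shorter: "length c < length b \<Longrightarrow> heap_index c < heap_index b"
proof -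
  assume "length c < length b"
  then have "2 * 2 ^ length c \<le> (2::nat) ^ length b"
    by (metis Suc_leI one_le_numeral power_Suc power_increasing)
  then show ?thesis using heap_index_bounds[of b] heap_index_bounds[of c] by linarith
qed

lemma heap_index_left:
  assumes "length c = length b" "left_of c b"
  shows "heap_index c < heap_index b"
proof -
  obtain p u v where c: "c = p @ False # u" and b: "b = p @ True # v"
    using assms by (auto simp: left_of_def lexord_def)
  have len: "length u = length v" using assms(1) c b by simp
  have "heap_index c < (2 * heap_index p + 1) * 2 ^ length u"
    using foldl_bounds[of "2 * heap_index p" u] by (simp add: c heap_index_append)
  moreover have "(2 * heap_index p + 1) * 2 ^ length v \<le> heap_index b"
    using foldl_bounds[of "2 * heap_index p + 1" v] by (simp add: b heap_index_append)
  ultimately show ?thesis using len by simp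
qed

lemma left_of_total: "b \<noteq> c \<Longrightarrow> left_of b c \<or> left_of c b"
  unfolding left_of_def using lexord_linear[of "{(False, True)}" b c] by auto

lemma heap_index_inj: "heap_index b = heap_index c \<Longrightarrow> b = c"
  by (metis heap_index_left heap_index_shorter left_of_total less_irrefl nat_neq_iff)

lemma heap_index_surj: "i \<ge> 1 \<Longrightarrow> \<exists>b. heap_index b = i"
proof (induction i rule: less_induct)
  case (less i)
  show ?case
  proof (cases "i = 1")
    case True
    then show ?thesis using heap_index_Nil by blast
  next
    case False
    then have "i div 2 < i" "i div 2 \<ge> 1" using less.prems by auto
    then obtain b where b: "heap_index b = i div 2" using less.IH by blast
    have "heap_index (b @ [odd i]) = i" by (simp add: b)
    then show ?thesis by blast
  qed
qed

lemma heap_card: "a \<ge> 1 \<Longrightarrow> card {b. a \<le> heap_index b \<and> heap_index b \<le> c} = Suc c - a"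
proof -
  assume a: "a \<ge> 1"
  have "bij_betw heap_index {b. a \<le> heap_index b \<and> heap_index b \<le> c} {a..c}"
  proof (rule bij_betwI')
    show "\<exists>b\<in>{b. a \<le> heap_index b \<and> heap_index b \<le> c}. y = heap_index b" if "y \<in> {a..c}" for y
      using that a heap_index_surj[of y] by fastforce
  qed (auto dest: heap_index_inj)
  then show ?thesis by (metis bij_betw_same_card card_atLeastAtMost)
qed

lemma finite_heap: "finite {b. heap_index b \<le> c}"
proof -
  have "inj_on heap_index {b. heap_index b \<le> c}" by (auto simp: inj_on_def dest: heap_index_inj)
  moreover have "heap_index ` {b. heap_index b \<le> c} \<subseteq> {..c}" by auto
  ultimately show ?thesis by (meson finite_atMost finite_imageD finite_subset)
qed

lemma heap_leaves:
  assumes "n \<ge> 1"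
  shows "leaves {b. heap_index b \<le> 2 * n - 1} = {b. n \<le> heap_index b \<and> heap_index b \<le> 2 * n - 1}"
  using assms by (auto simp: leaves_def all_bool_eq)

lemma complete_heap:
  assumes "n \<ge> 1"
  shows "complete_binary_tree {b. heap_index b \<le> 2 * n - 1}"
  unfolding complete_binary_tree_def binary_tree_def
proof (intro conjI)
  show "finite {b. heap_index b \<le> 2 * n - 1}" by (rule finite_heap)
  show "\<forall>b\<in>{b. heap_index b \<le> 2 * n - 1}. \<forall>c. length c < length b \<longrightarrow> c \<in> {b. heap_index b \<le> 2 * n - 1}"
    using heap_index_shorter by (fastforce dest: less_imp_le)
  show "\<forall>b\<in>{b. heap_index b \<le> 2 * n - 1}. \<forall>c. length c = length b \<and> left_of c b \<longrightarrow>
      c \<in> {b. heap_index b \<le> 2 * n - 1}"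
    using heap_index_left by (fastforce dest: less_imp_le)
  show "\<forall>b\<in>{b. heap_index b \<le> 2 * n - 1}.
      b @ [False] \<in> {b. heap_index b \<le> 2 * n - 1} \<longleftrightarrow> b @ [True] \<in> {b. heap_index b \<le> 2 * n - 1}"
  proof
    fix b
    have "2 * heap_index b \<le> 2 * n - 1 \<longleftrightarrow> 2 * heap_index b + 1 \<le> 2 * n - 1"
      using assms by presburger
    then show "b @ [False] \<in> {b. heap_index b \<le> 2 * n - 1} \<longleftrightarrow>
        b @ [True] \<in> {b. heap_index b \<le> 2 * n - 1}"
      by simp
  qed
qed (use assms in auto)

lemma complete_is_heap:
  assumes "complete_binary_tree N"
  shows "\<exists>n\<ge>1. N = {b. heap_index b \<le> 2 * n - 1}"
proof -
  have fin: "finite N" and root: "[] \<in> N"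
    and two: "\<And>b. b \<in> N \<Longrightarrow> b @ [False] \<in> N \<longleftrightarrow> b @ [True] \<in> N"
    and pre: "\<And>b x. b @ [x] \<in> N \<Longrightarrow> b \<in> N"
    and lev: "\<And>b c. b \<in> N \<Longrightarrow> length c < length b \<Longrightarrow> c \<in> N"
    and left: "\<And>b c. b \<in> N \<Longrightarrow> length c = length b \<Longrightarrow> left_of c b \<Longrightarrow> c \<in> N"
    using assms unfolding complete_binary_tree_def binary_tree_def by blast+
  have down: "c \<in> N" if "b \<in> N" "heap_index c \<le> heap_index b" for b c
  proof -
    consider "length c < length b" | "length b < length c" | "length c = length b" by linarith
    then show ?thesis
    proof cases
      case 2
      then show ?thesis using heap_index_shorter that(2) by fastforce
    next
      case 3
      then show ?thesis
        using left_of_total[of b c] heap_index_left[of b c] that left by (metis not_le)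
    qed (use that lev in blast)
  qed
  define M where "M = Max (heap_index ` N)"
  have "M \<in> heap_index ` N" unfolding M_def using fin root by (intro Max_in) auto
  then obtain m where m: "m \<in> N" "heap_index m = M" by auto
  have le: "heap_index b \<le> M" if "b \<in> N" for b
    unfolding M_def using fin that by (intro Max_ge) auto
  have N: "N = {b. heap_index b \<le> M}" using down[OF m(1)] m(2) le by blast
  have "odd M"
  proof (cases m rule: rev_cases)
    case Nil
    then have "M = 1" using m(2) by simp
    then show ?thesis by simp
  next
    case (snoc p x)
    have "x"
    proof (rule ccontr)
      assume "\<not> x"
      then have "p @ [True] \<in> N" using m snoc two pre by fastforce
      then show False using le[of "p @ [True]"] m(2) snoc \<open>\<not> x\<close> by simp
    qed
    then show ?thesis using m snoc by auto
  qed
  then obtain k where "M = 2 * k + 1" by (rule oddE)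
  then have "N = {b. heap_index b \<le> 2 * (k + 1) - 1}" using N by simp
  then show ?thesis by (intro exI[of _ "k + 1"]) simp
qed

lemma complete_binary_tree_ex1:
  assumes "n \<ge> 1"
  shows "\<exists>!N. complete_binary_tree N \<and> card (leaves N) = n"
proof (rule ex1I)
  have card: "card (leaves {b. heap_index b \<le> 2 * k - 1}) = k" if "k \<ge> 1" for k
    proof -
    have "card (leaves {b. heap_index b \<le> 2 * k - 1}) = Suc (2 * k - 1) - k"
      unfolding heap_leaves[OF that] using heap_card[OF that] .
    then show ?thesis using that by simp
  qed
  show "complete_binary_tree {b. heap_index b \<le> 2 * n - 1} \<and>
      card (leaves {b. heap_index b \<le> 2 * n - 1}) = n"
    using assms complete_heap card by blast
  show "N = {b. heap_index b \<le> 2 * n - 1}"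
    if "complete_binary_tree N \<and> card (leaves N) = n" for N
    using that complete_is_heap[of N] card by auto
qed

lemma complete_tree:
  assumes "n \<ge> 1"
  shows "complete_binary_tree (complete_tree n) \<and> card (leaves (complete_tree n)) = n"
  unfolding complete_tree_def using theI'[OF complete_binary_tree_ex1[OF assms]] .


section \<open>Segment trees\<close>

definition endpoints :: "real interval set \<Rightarrow> real set" where
  "endpoints I = lower ` I \<union> upper ` I"

fun segments_from :: "real list \<Rightarrow> real set list" where
  "segments_from [] = []"
| "segments_from [p] = [{p}, {p<..}]"
| "segments_from (p # q # ps) = {p} # {p<..<q} # segments_from (q # ps)"

definition elementary_segments :: "real interval set \<Rightarrow> real set list" where
  "elementary_segments I =
     (case sorted_list_of_set (endpoints I) of
        [] \<Rightarrow> [UNIV]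
      | p # ps \<Rightarrow> {..<p} # segments_from (p # ps))"

definition segment_tree :: "real interval set \<Rightarrow> bits set" where
  "segment_tree I = complete_tree (length (elementary_segments I))"

lemma segment_tree:
  "complete_binary_tree (segment_tree I)"
  "card (leaves (segment_tree I)) = length (elementary_segments I)"
proof -
  have "length (elementary_segments I) \<ge> 1"
    by (simp add: elementary_segments_def split: list.split)
  then show "complete_binary_tree (segment_tree I)"
    and "card (leaves (segment_tree I)) = length (elementary_segments I)"
    unfolding segment_tree_def using complete_tree by blast+
qed

text \<open>
  A leaf with \<open>j\<close> leaves to its left corresponds to the elementary segment with (0-based) index \<open>j\<close>.
\<close>

definition leaf_seg :: "real interval set \<Rightarrow> bits \<Rightarrow> real set" where
  "leaf_seg I w = elementary_segments I ! card {u \<in> leaves (segment_tree I). left_of u w}"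

definition seg :: "real interval set \<Rightarrow> bits \<Rightarrow> real set" where
  "seg I v = (\<Union>w \<in> {w \<in> leaves (segment_tree I). prefix v w}. leaf_seg I w)"

definition canonical_partition :: "real interval set \<Rightarrow> real interval \<Rightarrow> bits set" where
  "canonical_partition I x =
     {v \<in> segment_tree I. seg I v \<subseteq> set_of x \<and> (v \<noteq> [] \<longrightarrow> \<not> seg I (butlast v) \<subseteq> set_of x)}"

definition leaf_of :: "real interval set \<Rightarrow> real interval \<Rightarrow> bits" where
  "leaf_of I x = (THE w. w \<in> leaves (segment_tree I) \<and> lower x \<in> seg I w)"


section \<open>Forward reduction\<close>

text \<open>
  The point variable \<open>X\<^sub>j\<close> is the pair \<open>(X, j)\<close>, with \<open>1 \<le> j \<le> k\<^sub>X\<close>.  The hyperedge of the reduced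
  query obtained from \<open>e\<close> under the choice \<open>\<sigma>\<close> of permutations is labelled \<open>(e, \<sigma>)\<close>, so that a single
  database interprets all the reduced queries.
\<close>

type_synonym ('v, 'e) choice = "'v \<Rightarrow> 'e list"

definition interval_values ::
    "('v, 'e) hypergraph \<Rightarrow> ('e, 'v, real interval) database \<Rightarrow> 'v \<Rightarrow> real interval set" where
  "interval_values H D X = (\<Union>e\<in>edges_at H X. (\<lambda>t. t X) ` D e)"

definition choices :: "('v, 'e) hypergraph \<Rightarrow> ('v, 'e) choice set" where
  "choices H = (\<Pi>\<^sub>E X\<in>verts H. permutations_of_set (edges_at H X))"

definition position :: "('v, 'e) choice \<Rightarrow> 'v \<Rightarrow> 'e \<Rightarrow> nat" where
  "position \<sigma> X e = (THE i. 1 \<le> i \<and> i \<le> length (\<sigma> X) \<and> \<sigma> X ! (i - 1) = e)"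

definition reduced_ends ::
    "('v, 'e) hypergraph \<Rightarrow> 'e \<times> ('v, 'e) choice \<Rightarrow> ('v \<times> nat) set" where
  "reduced_ends H = (\<lambda>(e, \<sigma>). SIGMA X:ends H e. {1..position \<sigma> X e})"

definition reduced_query ::
    "('v, 'e) hypergraph \<Rightarrow> ('v, 'e) choice \<Rightarrow> ('v \<times> nat, 'e \<times> ('v, 'e) choice) hypergraph" where
  "reduced_query H \<sigma> =
     \<lparr> verts = (SIGMA X:verts H. {1..card (edges_at H X)}),
       edges = (\<lambda>e. (e, \<sigma>)) ` edges H,
       ends = reduced_ends H \<rparr>"

definition reduced_queries ::
    "('v, 'e) hypergraph \<Rightarrow> ('v \<times> nat, 'e \<times> ('v, 'e) choice) hypergraph set" where
  "reduced_queries H = reduced_query H ` choices H"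

definition concat_upto :: "('v \<times> nat \<Rightarrow> bits) \<Rightarrow> 'v \<Rightarrow> nat \<Rightarrow> bits" where
  "concat_upto s X i = concat (map (\<lambda>j. s (X, j)) [1..<Suc i])"

definition reduced_database ::
    "('v, 'e) hypergraph \<Rightarrow> ('e, 'v, real interval) database \<Rightarrow>
     ('e \<times> ('v, 'e) choice, 'v \<times> nat, bits) database" where
  "reduced_database H D = (\<lambda>(e, \<sigma>).
     {s \<in> reduced_ends H (e, \<sigma>) \<rightarrow>\<^sub>E UNIV.
        \<exists>t\<in>D e. \<forall>X\<in>ends H e.
          let i = position \<sigma> X e; k = card (edges_at H X); I = interval_values H D X in
          (i < k \<longrightarrow> concat_upto s X i \<in> canonical_partition I (t X)) \<and>
          (i = k \<longrightarrow> concat_upto s X i = leaf_of I (t X))})"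

end

theory Submission
  imports Defs
begin

text \<open>
  If the chosen intervals at a vertex meet, then they contain the largest of their left endpoints,
  \<open>p\<close>. The leaf of \<open>p\<close> has segment \<open>{p}\<close>, so every chosen interval has a node of its canonical
  partition on the path from the root to this leaf. Listing the hyperedges by the depth of these
  nodes, with the hyperedge of \<open>p\<close> last, cuts the path into the bitstrings of the point variables.
  Conversely, the bitstrings of a vertex spell a path to the leaf of some left endpoint, and every
  chosen interval contains the segment of a node on this path, hence that left endpoint.
\<close>

section \<open>Segment trees\<close>

text \<open>The union is tracked exactly because the induction lives on it: the segments of the tail
  all lie in \<open>{q..}\<close>, so the two new ones, \<open>{p}\<close> and
  \<open>{p<..<q}\<close>, cannot meet them. The last conjunct holds because the nondegenerate
  segments are open at the listed points.\<close>

lemma segments_from_partition: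
  assumes "sorted_wrt (<) (p # ps)"
  shows "\<Union>(set (segments_from (p # ps))) = {p..} \<and> sorted_wrt disjnt (segments_from (p # ps)) \<and>
    (\<forall>S\<in>set (segments_from (p # ps)). \<forall>x\<in>S \<inter> set (p # ps). S = {x})"
  using assms
proof (induction ps arbitrary: p)
  case Nil
  show ?case by (auto simp: disjnt_def)
next
  case (Cons q ps)
  have pq: "p < q" and sorted: "sorted_wrt (<) (q # ps)" and gt: "\<forall>x\<in>set (q # ps). q \<le> x"
    using Cons.prems by auto
  note IH = Cons.IH[OF sorted]
  have sub: "S \<subseteq> {q..}" if "S \<in> set (segments_from (q # ps))" for S
    using IH that by blast
  have "\<Union>(set (segments_from (p # q # ps))) = {p} \<union> ({p<..<q} \<union> {q..})"
    using IH by simp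
  also have "\<dots> = {p..}" using pq by auto
  finally have "\<Union>(set (segments_from (p # q # ps))) = {p..}" .
  moreover have "disjnt {p} {p<..<q}" by simp
  moreover have "disjnt {p} S" "disjnt {p<..<q} S" if "S \<in> set (segments_from (q # ps))" for S
    using sub[OF that] pq by (auto simp: disjnt_iff)
  then have "sorted_wrt disjnt (segments_from (p # q # ps))"
    using IH by simp
  moreover have "S = {x}"
    if "S \<in> set (segments_from (p # q # ps))" "x \<in> S" "x \<in> set (p # q # ps)" for S x
  proof -
    consider "S = {p}" | "S = {p<..<q}" | "S \<in> set (segments_from (q # ps))"
      using \<open>S \<in> set (segments_from (p # q # ps))\<close> by auto
    then show ?thesis
    proof cases
      case 1
      then show ?thesis using that by simp
    next
      case 2
      then have "p < x" "x < q" using that by auto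
      then show ?thesis using that(3) gt by auto
    next
      case 3
      then have "x \<noteq> p" using sub that(2) pq by fastforce
      then show ?thesis using IH 3 that by auto
    qed
  qed
  ultimately show ?case by blast
qed

lemma elementary_segments_partition:
  assumes "finite I"
  shows "\<Union>(set (elementary_segments I)) = UNIV"
    and "sorted_wrt disjnt (elementary_segments I)"
    and "\<lbrakk>S \<in> set (elementary_segments I); x \<in> S; x \<in> endpoints I\<rbrakk> \<Longrightarrow> S = {x}"
proof -
  have fin: "finite (endpoints I)" using assms by (simp add: endpoints_def)
  have "\<Union>(set (elementary_segments I)) = UNIV \<and> sorted_wrt disjnt (elementary_segments I) \<and>
    (\<forall>S\<in>set (elementary_segments I). \<forall>x\<in>S \<inter> endpoints I. S = {x})"
  proof (cases "sorted_list_of_set (endpoints I)")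
    case Nil
    then have "endpoints I = {}" using fin by simp
    then show ?thesis using Nil by (simp add: elementary_segments_def)
  next
    case (Cons p ps)
    have set: "endpoints I = set (p # ps)"
      using set_sorted_list_of_set[OF fin] Cons by simp
    have sorted: "sorted_wrt (<) (p # ps)"
      using strict_sorted_list_of_set[of "endpoints I"] Cons by simp
    note P = segments_from_partition[OF sorted]
    have le: "p \<le> x" if "x \<in> set (p # ps)" for x using sorted that by auto
    have eq: "elementary_segments I = {..<p} # segments_from (p # ps)"
      using Cons by (simp add: elementary_segments_def)
    have "\<Union>(set (elementary_segments I)) = {..<p} \<union> {p..}" using P by (simp add: eq)
    moreover have "disjnt {..<p} S" if "S \<in> set (segments_from (p # ps))" for S
    proof -
      have "S \<subseteq> {p..}" using P that by blast
      then show ?thesis by (auto simp: disjnt_iff)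
    qed
    then have "sorted_wrt disjnt (elementary_segments I)"
      using P by (simp add: eq)
    moreover have "\<forall>S\<in>set (elementary_segments I). \<forall>x\<in>S \<inter> endpoints I. S = {x}"
    proof (intro ballI)
      fix S x
      assume "S \<in> set (elementary_segments I)" and x: "x \<in> S \<inter> endpoints I"
      \<comment> \<open>\<open>p\<close> is the least endpoint, so the unbounded segment to its left
        contains no endpoint.\<close>
      moreover have "S \<noteq> {..<p}" using x le[of x] by (auto simp: set)
      ultimately have "S \<in> set (segments_from (p # ps))" by (simp add: eq)
      then show "S = {x}" using P x set by blast
    qed
    ultimately show ?thesis by auto
  qed
  then show "\<Union>(set (elementary_segments I)) = UNIV"
    and "sorted_wrt disjnt (elementary_segments I)"
    and "\<lbrakk>S \<in> set (elementary_segments I); x \<in> S; x \<in> endpoints I\<rbrakk> \<Longrightarrow> S = {x}"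
    by blast+
qed

text \<open>Uniqueness is stated for the index rather than for the segment, because leaves are
  matched with segments by index.\<close>

lemma elementary_segments_ex1:
  assumes "finite I"
  shows "\<exists>!j. j < length (elementary_segments I) \<and> x \<in> elementary_segments I ! j"
proof (rule ex_ex1I)
  have "x \<in> \<Union>(set (elementary_segments I))"
    using elementary_segments_partition(1)[OF assms] by blast
  then show "\<exists>j. j < length (elementary_segments I) \<and> x \<in> elementary_segments I ! j"
    by (auto simp: in_set_conv_nth)
next
  fix i j
  assume "i < length (elementary_segments I) \<and> x \<in> elementary_segments I ! i"
    and "j < length (elementary_segments I) \<and> x \<in> elementary_segments I ! j"
  then show "i = j"
    using elementary_segments_partition(2)[OF assms]
      sorted_wrt_nth_less[of disjnt "elementary_segments I" i j]
      sorted_wrt_nth_less[of disjnt "elementary_segments I" j i]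
    by (cases i j rule: linorder_cases) (auto simp: disjnt_iff)
qed

section \<open>Leaves in left-to-right order and their segments\<close>

lemma left_of_trans: "left_of a b \<Longrightarrow> left_of b c \<Longrightarrow> left_of a c"
  unfolding left_of_def by (rule lexord_trans) (auto simp: trans_def)

lemma left_of_irrefl: "\<not> left_of a a"
  unfolding left_of_def by (rule lexord_irreflexive) auto

text \<open>\<open>left_of\<close> is a strict linear order, so the number of elements to the left
  grows strictly along \<open>A\<close> and stays below \<open>card A\<close>; an injection between
  finite sets of equal size is onto.\<close>

lemma rank_bij_betw:
  assumes "finite A"
  shows "bij_betw (\<lambda>w. card {u \<in> A. left_of u w}) A {..<card A}"
proof -
  have less: "card {u \<in> A. left_of u v} < card {u \<in> A. left_of u w}"
    if "v \<in> A" "left_of v w" for v w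
    using that assms left_of_irrefl[of v]
    by (intro psubset_card_mono) (auto intro: left_of_trans)
  have inj: "inj_on (\<lambda>w. card {u \<in> A. left_of u w}) A"
  proof (rule inj_onI, rule ccontr)
    fix v w
    assume "v \<in> A" "w \<in> A" "v \<noteq> w"
      and eq: "card {u \<in> A. left_of u v} = card {u \<in> A. left_of u w}"
    then show False using left_of_total[of v w] less[of v w] less[of w v] by auto
  qed
  have "card {u \<in> A. left_of u w} < card A" if "w \<in> A" for w
    using that assms left_of_irrefl[of w] by (intro psubset_card_mono) auto
  then have "(\<lambda>w. card {u \<in> A. left_of u w}) ` A \<subseteq> {..<card A}" by auto
  moreover have "card ((\<lambda>w. card {u \<in> A. left_of u w}) ` A) = card {..<card A}"
    using inj by (simp add: card_image)
  ultimately show ?thesis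
    using inj by (simp add: bij_betw_def card_subset_eq)
qed

lemma binary_tree_prefix_closed:
  assumes "binary_tree N" "prefix v w" "w \<in> N"
  shows "v \<in> N"
proof -
  have "v @ z \<in> N \<Longrightarrow> v \<in> N" for z
    using assms(1) by (induction z rule: rev_induct) (auto simp: binary_tree_def simp flip: append_assoc)
  then show ?thesis using assms(2,3) by (auto simp: prefix_def)
qed

text \<open>A proper extension of \<open>v\<close> in the tree would, by closure under prefixes,
  bring a child of \<open>v\<close> with it. This makes the segment of a leaf a single elementary
  segment.\<close>

lemma leaf_prefix_eq:
  assumes "binary_tree N" "v \<in> leaves N" "w \<in> leaves N" "prefix v w"
  shows "v = w"
proof (rule ccontr)
  assume "v \<noteq> w"
  then obtain x z where "w = v @ x # z"
    using assms(4) by (metis append_Nil2 neq_Nil_conv prefix_def)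
  then have "prefix (v @ [x]) w" by simp
  then have "v @ [x] \<in> N"
    using assms(1,3) binary_tree_prefix_closed by (auto simp: leaves_def)
  then show False using assms(2) by (auto simp: leaves_def)
qed

lemma binary_tree_segment_tree: "binary_tree (segment_tree I)"
  using segment_tree(1)[of I] by (simp add: complete_binary_tree_def)

lemma finite_leaves_segment_tree: "finite (leaves (segment_tree I))"
  using binary_tree_segment_tree[of I] by (auto simp: binary_tree_def leaves_def)

lemma seg_leaf: "w \<in> leaves (segment_tree I) \<Longrightarrow> seg I w = leaf_seg I w"
  using leaf_prefix_eq[OF binary_tree_segment_tree] by (auto simp: seg_def)

lemma seg_antimono: "prefix v w \<Longrightarrow> seg I w \<subseteq> seg I v"
  by (auto simp: seg_def)

lemma leaf_index:
  "bij_betw (\<lambda>w. card {u \<in> leaves (segment_tree I). left_of u w})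
    (leaves (segment_tree I)) {..<length (elementary_segments I)}"
  using rank_bij_betw[OF finite_leaves_segment_tree, of I] by (simp add: segment_tree(2))

text \<open>The index of the elementary segment around \<open>x\<close> is unique, and ranks match
  leaves with indices bijectively. This justifies the description operator in
  \<open>leaf_of\<close>.\<close>

lemma leaf_ex1:
  assumes "finite I"
  shows "\<exists>!w. w \<in> leaves (segment_tree I) \<and> x \<in> seg I w"
proof -
  let ?r = "\<lambda>w. card {u \<in> leaves (segment_tree I). left_of u w}"
  obtain j where j: "j < length (elementary_segments I)" "x \<in> elementary_segments I ! j"
    and uniq: "\<And>i. i < length (elementary_segments I) \<Longrightarrow> x \<in> elementary_segments I ! i \<Longrightarrow> i = j"
    by (rule ex1E[OF elementary_segments_ex1[OF assms, of x]]) iprover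
  obtain w where w: "w \<in> leaves (segment_tree I)" "?r w = j"
  proof -
    have "j \<in> ?r ` leaves (segment_tree I)"
      using j(1) leaf_index[of I] unfolding bij_betw_def by simp
    then show thesis using that by auto
  qed
  show ?thesis
  proof (rule ex1I)
    show "w \<in> leaves (segment_tree I) \<and> x \<in> seg I w"
      using w j by (simp add: seg_leaf leaf_seg_def)
  next
    fix v
    assume v: "v \<in> leaves (segment_tree I) \<and> x \<in> seg I v"
    then have "?r v < length (elementary_segments I)"
      using leaf_index[of I] by (auto simp: bij_betw_def)
    then have "?r v = j"
      using v seg_leaf[of v I] by (intro uniq) (auto simp: leaf_seg_def)
    then show "v = w"
      using inj_onD[OF bij_betw_imp_inj_on[OF leaf_index[of I]], of v w] v w by simp
  qed
qed

lemma leaf_of: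
  assumes "finite I"
  shows "leaf_of I x \<in> leaves (segment_tree I)" "lower x \<in> seg I (leaf_of I x)"
  using theI'[OF leaf_ex1[OF assms, of "lower x"]] by (simp_all add: leaf_of_def)

text \<open>Since \<open>x \<in> I\<close>, its left endpoint is one of the points that cut the
  line, and an elementary segment containing such a point is a singleton.\<close>

lemma seg_leaf_of:
  assumes "finite I" "x \<in> I"
  shows "seg I (leaf_of I x) = {lower x}"
proof -
  have "leaf_seg I (leaf_of I x) \<in> set (elementary_segments I)"
    using bij_betwE[OF leaf_index] leaf_of(1)[OF assms(1)] by (simp add: leaf_seg_def)
  moreover have "lower x \<in> endpoints I" using assms(2) by (simp add: endpoints_def)
  ultimately show ?thesis
    using elementary_segments_partition(3)[OF assms(1)] leaf_of[OF assms(1), of x]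
    by (simp add: seg_leaf)
qed

section \<open>Canonical partitions along a path\<close>

text \<open>The shortest prefix of \<open>w\<close> whose segment lies inside \<open>x\<close>
  works: its minimality is the condition on the parent.\<close>

lemma canonical_partition_prefix_ex:
  assumes "w \<in> segment_tree I" "seg I w \<subseteq> set_of x"
  shows "\<exists>v\<in>canonical_partition I x. prefix v w"
proof -
  let ?P = "\<lambda>n. seg I (take n w) \<subseteq> set_of x"
  define n where "n = (LEAST n. ?P n)"
  have len: "?P (length w)" using assms(2) by simp
  have n: "?P n" "n \<le> length w"
    unfolding n_def using LeastI[of ?P, OF len] Least_le[of ?P, OF len] by auto
  have "\<not> ?P (n - 1)" if "n \<noteq> 0"
    using not_less_Least[of "n - 1" ?P] that unfolding n_def by simp
  moreover have "butlast (take n w) = take (n - 1) w" using n(2) by (rule butlast_take)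
  moreover have "take n w \<in> segment_tree I"
    using binary_tree_prefix_closed[OF binary_tree_segment_tree take_is_prefix assms(1)] .
  ultimately have "take n w \<in> canonical_partition I x"
    using n by (auto simp: canonical_partition_def)
  then show ?thesis using take_is_prefix by blast
qed

lemma canonical_partition_seg: "v \<in> canonical_partition I x \<Longrightarrow> seg I v \<subseteq> set_of x"
  by (simp add: canonical_partition_def)

section \<open>Forward reduction\<close>

lemma position_nth:
  assumes "distinct (\<sigma> X)" "1 \<le> i" "i \<le> length (\<sigma> X)"
  shows "position \<sigma> X (\<sigma> X ! (i - 1)) = i"
  unfolding position_def
proof (rule the_equality)
  fix j
  assume "1 \<le> j \<and> j \<le> length (\<sigma> X) \<and> \<sigma> X ! (j - 1) = \<sigma> X ! (i - 1)"
  \<comment> \<open>The bound \<open>1 \<le> j\<close> matters: subtraction on naturals truncates,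
    so 0 and 1 would name the same list entry.\<close>
  then have "j - 1 = i - 1" "1 \<le> j"
    using assms nth_eq_iff_index_eq[OF assms(1), of "j - 1" "i - 1"] by auto
  then show "j = i" using assms(2) by simp
qed (use assms in auto)

lemma position_of_choice:
  assumes "\<sigma> \<in> choices H" "hypergraph H" "e \<in> edges_at H X"
  shows "position \<sigma> X e \<in> {1..card (edges_at H X)}" "\<sigma> X ! (position \<sigma> X e - 1) = e"
proof -
  have "X \<in> verts H" using assms(2,3) by (auto simp: hypergraph_def edges_at_def)
  then have "\<sigma> X \<in> permutations_of_set (edges_at H X)"
    using assms(1) by (auto simp: choices_def)
  then have *: "distinct (\<sigma> X)" "set (\<sigma> X) = edges_at H X"
    by (auto simp: permutations_of_set_def)
  then have len: "length (\<sigma> X) = card (edges_at H X)" by (metis distinct_card)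
  obtain j where j: "j < length (\<sigma> X)" "\<sigma> X ! j = e"
    using assms(3) * by (metis in_set_conv_nth)
  then have "position \<sigma> X e = Suc j"
    using position_nth[of \<sigma> X "Suc j", OF *(1)] by simp
  then show "position \<sigma> X e \<in> {1..card (edges_at H X)}" "\<sigma> X ! (position \<sigma> X e - 1) = e"
    using j len by auto
qed

text \<open>Slices of \<open>w\<close> between successive cut points telescope; equal cut points
  give empty slices.\<close>

lemma concat_slices:
  assumes "n 0 = 0" "\<And>j. j < i \<Longrightarrow> n j \<le> n (Suc j)"
  shows "concat (map (\<lambda>j. drop (n (j - 1)) (take (n j) w)) [1..<Suc i]) = take (n i) w"
  using assms(2)
proof (induction i)
  case 0
  then show ?case using assms(1) by simp
next
  case (Suc i)
  \<comment> \<open>In this form the part already assembled and the next slice are a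
    \<open>take\<close> and a \<open>drop\<close> of one list at the same point and rejoin;
    \<open>take_take\<close> would undo it.\<close>
  have "take (n i) w = take (n i) (take (n (Suc i)) w)" using Suc.prems[of i] by (simp add: min_def)
  then show ?case using Suc by (simp del: take_take)
qed

text \<open>Prefixes of one string are ordered by their lengths, so sorting by length yields a
  chain, and \<open>s\<close> consists of the pieces between successive members.\<close>

lemma prefix_chain_slices:
  assumes "finite A" "a \<in> A" and v: "\<And>e. e \<in> A \<Longrightarrow> prefix (v e) (v a)"
  shows "\<exists>p\<in>permutations_of_set A. p ! (card A - 1) = a \<and>
    (\<exists>s. \<forall>i\<in>{1..card A}. concat (map s [1..<Suc i]) = v (p ! (i - 1)))"
proof -
  obtain q where q: "set q = A - {a}" "distinct q"
    using finite_distinct_list[of "A - {a}"] assms(1) by auto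
  let ?l = "\<lambda>e. length (v e)"
  \<comment> \<open>\<open>a\<close> is appended after sorting, since another string as long as
    \<open>v a\<close> could otherwise come last.\<close>
  define p where "p = sort_key ?l q @ [a]"
  have p: "p \<in> permutations_of_set A"
    using q assms(2) by (auto simp: p_def permutations_of_set_def)
  then have set: "set p = A" and len: "length p = card A"
    by (auto simp: permutations_of_set_def distinct_card)
  have last: "p ! (card A - 1) = a" using len by (simp add: p_def nth_append flip: len)
  have sorted: "sorted (map ?l p)"
    using v q assms(2) by (auto simp: p_def sorted_append prefix_length_le)
  \<comment> \<open>Cut points along \<open>v a\<close>; the value 0 at 0 makes the first slice
    start at the root.\<close>
  define n where "n j = (if j = 0 then 0 else ?l (p ! (j - 1)))" for j
  have mono: "n j \<le> n (Suc j)" if "j < card A" for j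
    using sorted_nth_mono[OF sorted, of "j - 1" j] that len by (auto simp: n_def)
  have "concat (map (\<lambda>j. drop (n (j - 1)) (take (n j) (v a))) [1..<Suc i]) = v (p ! (i - 1))"
    if "i \<in> {1..card A}" for i
  proof -
    have "concat (map (\<lambda>j. drop (n (j - 1)) (take (n j) (v a))) [1..<Suc i]) = take (n i) (v a)"
      by (rule concat_slices) (use that mono in \<open>auto simp: n_def\<close>)
    moreover have "p ! (i - 1) \<in> A"
      using that set len
      by (metis Suc_le_eq Suc_pred' atLeastAtMost_iff nth_mem One_nat_def)
    ultimately show ?thesis
      using v[of "p ! (i - 1)"] that by (auto simp: n_def prefix_def)
  qed
  then show ?thesis using p last by blast
qed

text \<open>This is the forward direction at a single vertex: \<open>A\<close> plays its hyperedges,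
  and \<open>s j\<close> is the value for its \<open>j\<close>-th point variable.\<close>

lemma vertex_slices:
  assumes "finite A" "finite I" and t: "\<And>e. e \<in> A \<Longrightarrow> t e \<in> I"
    and meet: "(\<Inter>e\<in>A. set_of (t e)) \<noteq> {}"
  shows "\<exists>p\<in>permutations_of_set A. \<exists>s. \<forall>i\<in>{1..card A}.
    (i < card A \<longrightarrow> concat (map s [1..<Suc i]) \<in> canonical_partition I (t (p ! (i - 1)))) \<and>
    (i = card A \<longrightarrow> concat (map s [1..<Suc i]) = leaf_of I (t (p ! (i - 1))))"
proof (cases "A = {}")
  case False
  obtain a where a: "a \<in> A" "\<And>e. e \<in> A \<Longrightarrow> lower (t e) \<le> lower (t a)"
  proof -
    have "Max ((\<lambda>e. lower (t e)) ` A) \<in> (\<lambda>e. lower (t e)) ` A" using assms(1) False by simp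
    then obtain a where "a \<in> A" "lower (t a) = Max ((\<lambda>e. lower (t e)) ` A)" by auto
    then show ?thesis using that[of a] assms(1) by simp
  qed
  obtain q where q: "\<And>e. e \<in> A \<Longrightarrow> q \<in> set_of (t e)" using meet by blast
  \<comment> \<open>With a common point \<open>q\<close>:
    \<open>lower (t e) \<le> lower (t a) \<le> q \<le> upper (t e)\<close>.\<close>
  have in_t: "lower (t a) \<in> set_of (t e)" if "e \<in> A" for e
    using a(2)[OF that] q[OF that] q[OF a(1)] by (auto simp: set_of_eq)
  define w where "w = leaf_of I (t a)"
  have w: "w \<in> segment_tree I" "seg I w = {lower (t a)}"
    using leaf_of(1)[OF assms(2)] seg_leaf_of[OF assms(2) t[OF a(1)]]
    by (auto simp: w_def leaves_def)
  have "\<forall>e\<in>A. \<exists>v\<in>canonical_partition I (t e). prefix v w"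
    using canonical_partition_prefix_ex[OF w(1)] w(2) in_t by simp
  then obtain v where v: "\<And>e. e \<in> A \<Longrightarrow> v e \<in> canonical_partition I (t e)"
    "\<And>e. e \<in> A \<Longrightarrow> prefix (v e) w"
    by metis
  \<comment> \<open>The canonical node of \<open>a\<close> is replaced by the whole leaf
    \<open>w\<close>, as the last position calls for a leaf; the other nodes are prefixes of
    \<open>w\<close>, so the chain survives.\<close>
  have "\<exists>p\<in>permutations_of_set A. p ! (card A - 1) = a \<and>
    (\<exists>s. \<forall>i\<in>{1..card A}. concat (map s [1..<Suc i]) = (v(a := w)) (p ! (i - 1)))"
    using a(1) v(2) by (intro prefix_chain_slices assms(1)) auto
  then obtain p s where p: "p \<in> permutations_of_set A" "p ! (card A - 1) = a"
    and s: "\<And>i. i \<in> {1..card A} \<Longrightarrow> concat (map s [1..<Suc i]) = (v(a := w)) (p ! (i - 1))"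
    by blast
  have p': "set p = A" "distinct p" using p(1) by (auto simp: permutations_of_set_def)
  then have len: "length p = card A" by (metis distinct_card)
  have "(i < card A \<longrightarrow> concat (map s [1..<Suc i]) \<in> canonical_partition I (t (p ! (i - 1)))) \<and>
    (i = card A \<longrightarrow> concat (map s [1..<Suc i]) = leaf_of I (t (p ! (i - 1))))"
    if i: "i \<in> {1..card A}" for i
  proof -
    have "p ! (i - 1) \<in> A" using i p' len nth_mem[of "i - 1" p] by auto
    moreover have "p ! (i - 1) \<noteq> a" if "i < card A"
      using nth_eq_iff_index_eq[OF p'(2), of "i - 1" "card A - 1"] p(2) i that len by auto
    ultimately show ?thesis
      unfolding s[OF i] using v(1) p(2) by (auto simp: w_def)
  qed
  then show ?thesis using p(1) by blast
qed auto

lemma finite_interval_values: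
  assumes "hypergraph H" "database_over H D"
  shows "finite (interval_values H D X)"
  using assms by (auto simp: hypergraph_def database_over_def interval_values_def edges_at_def)

lemma in_reduced_ends: "(X, j) \<in> reduced_ends H (e, \<sigma>) \<longleftrightarrow> X \<in> ends H e \<and> j \<in> {1..position \<sigma> X e}"
  by (auto simp: reduced_ends_def)

lemma edges_at_reduced_query:
  "edges_at (reduced_query H \<sigma>) (X, j) =
    (\<lambda>e. (e, \<sigma>)) ` {e \<in> edges_at H X. j \<in> {1..position \<sigma> X e}}"
  by (auto simp: edges_at_def reduced_query_def in_reduced_ends)

lemma concat_upto_cong:
  "(\<And>j. j \<in> {1..i} \<Longrightarrow> s (X, j) = s' (X, j)) \<Longrightarrow> concat_upto s X i = concat_upto s' X i"
  unfolding concat_upto_def by (rule arg_cong[where f = concat]) (auto intro!: map_cong)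

section \<open>From the intersection join to an equality join\<close>

lemma ij_true_imp_reduced:
  assumes H: "hypergraph H" and D: "database_over H D" and "ij_true H D"
  shows "\<exists>Q\<in>reduced_queries H. ej_true Q (reduced_database H D)"
proof -
  obtain t where t: "t \<in> (\<Pi>\<^sub>E e\<in>edges H. D e)"
    and meet: "\<And>X. X \<in> verts H \<Longrightarrow> (\<Inter>e\<in>edges_at H X. set_of (t e X)) \<noteq> {}"
    using assms(3) by (auto simp: ij_true_def)
  have "\<exists>p\<in>permutations_of_set (edges_at H X). \<exists>s. \<forall>i\<in>{1..card (edges_at H X)}.
    (i < card (edges_at H X) \<longrightarrow>
      concat (map s [1..<Suc i]) \<in> canonical_partition (interval_values H D X) (t (p ! (i - 1)) X)) \<and>
    (i = card (edges_at H X) \<longrightarrow>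
      concat (map s [1..<Suc i]) = leaf_of (interval_values H D X) (t (p ! (i - 1)) X))"
    if "X \<in> verts H" for X
  proof (rule vertex_slices[where t = "\<lambda>e. t e X"])
    show "finite (edges_at H X)" using H by (simp add: hypergraph_def edges_at_def)
    show "t e X \<in> interval_values H D X" if "e \<in> edges_at H X" for e
      using that t by (auto simp: interval_values_def edges_at_def PiE_iff)
  qed (use meet that finite_interval_values[OF H D] in auto)
  then obtain p s where p: "\<And>X. X \<in> verts H \<Longrightarrow> p X \<in> permutations_of_set (edges_at H X)"
    and s: "\<And>X i. X \<in> verts H \<Longrightarrow> i \<in> {1..card (edges_at H X)} \<Longrightarrow>
      (i < card (edges_at H X) \<longrightarrow> concat (map (s X) [1..<Suc i])
        \<in> canonical_partition (interval_values H D X) (t (p X ! (i - 1)) X)) \<and>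
      (i = card (edges_at H X) \<longrightarrow> concat (map (s X) [1..<Suc i])
        = leaf_of (interval_values H D X) (t (p X ! (i - 1)) X))"
    by metis
  define \<sigma> where "\<sigma> = restrict p (verts H)"
  have \<sigma>: "\<sigma> \<in> choices H" using p by (auto simp: \<sigma>_def choices_def)
  \<comment> \<open>All tuples are restrictions of one global valuation \<open>s\<close>, so the
    equality joins hold automatically; only membership in the reduced relations needs work.\<close>
  define u where
    "u = (\<lambda>(e, \<tau>)\<in>edges (reduced_query H \<sigma>). restrict (\<lambda>(X, j). s X j) (reduced_ends H (e, \<tau>)))"
  have u: "u (e, \<sigma>) = restrict (\<lambda>(X, j). s X j) (reduced_ends H (e, \<sigma>))" if "e \<in> edges H" for e
    using that by (simp add: u_def reduced_query_def)
  have "u (e, \<sigma>) \<in> reduced_database H D (e, \<sigma>)" if e: "e \<in> edges H" for e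
  proof -
    have "let i = position \<sigma> X e; k = card (edges_at H X); I = interval_values H D X in
          (i < k \<longrightarrow> concat_upto (u (e, \<sigma>)) X i \<in> canonical_partition I (t e X)) \<and>
          (i = k \<longrightarrow> concat_upto (u (e, \<sigma>)) X i = leaf_of I (t e X))"
      if X: "X \<in> ends H e" for X
    proof -
      have V: "X \<in> verts H" and eX: "e \<in> edges_at H X"
        using H e X by (auto simp: hypergraph_def edges_at_def)
      have "concat_upto (u (e, \<sigma>)) X (position \<sigma> X e)
          = concat_upto (\<lambda>(X, j). s X j) X (position \<sigma> X e)"
        by (rule concat_upto_cong) (simp add: u[OF e] in_reduced_ends X)
      then have "concat_upto (u (e, \<sigma>)) X (position \<sigma> X e)
          = concat (map (s X) [1..<Suc (position \<sigma> X e)])"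
        by (simp add: concat_upto_def)
      \<comment> \<open>The property of \<open>s\<close> speaks of list entries; at the position of
        \<open>e\<close> it becomes the one required of \<open>e\<close>.\<close>
      moreover have "p X ! (position \<sigma> X e - 1) = e"
        using position_of_choice(2)[OF \<sigma> H eX] V by (simp add: \<sigma>_def)
      ultimately show ?thesis
        using s[OF V position_of_choice(1)[OF \<sigma> H eX]] unfolding Let_def by metis
    qed
    moreover have "t e \<in> D e" using t e by auto
    moreover have "u (e, \<sigma>) \<in> reduced_ends H (e, \<sigma>) \<rightarrow>\<^sub>E UNIV" by (simp add: u[OF e])
    ultimately show ?thesis unfolding reduced_database_def by blast
  qed
  then have "u \<in> (\<Pi>\<^sub>E e\<in>edges (reduced_query H \<sigma>). reduced_database H D e)"
    by (auto simp: reduced_query_def u_def)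
  moreover have "u e X = u f X"
    if "e \<in> edges_at (reduced_query H \<sigma>) X" "f \<in> edges_at (reduced_query H \<sigma>) X" for e f X
    using that
    by (cases X) (auto simp: edges_at_reduced_query u in_reduced_ends edges_at_def[of H])
  ultimately have "ej_true (reduced_query H \<sigma>) (reduced_database H D)"
    unfolding ej_true_def by blast
  then show ?thesis using \<sigma> by (auto simp: reduced_queries_def)
qed

section \<open>From an equality join back to the intersection join\<close>

lemma reduced_imp_ij_true:
  assumes H: "hypergraph H" and D: "database_over H D" and \<sigma>: "\<sigma> \<in> choices H"
    and "ej_true (reduced_query H \<sigma>) (reduced_database H D)"
  shows "ij_true H D"
proof -
  obtain u where u: "u \<in> (\<Pi>\<^sub>E e\<in>edges (reduced_query H \<sigma>). reduced_database H D e)"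
    and eq: "\<And>Y e f. \<lbrakk>Y \<in> verts (reduced_query H \<sigma>); e \<in> edges_at (reduced_query H \<sigma>) Y;
      f \<in> edges_at (reduced_query H \<sigma>) Y\<rbrakk> \<Longrightarrow> u e Y = u f Y"
    using assms(4) unfolding ej_true_def by blast
  have "u (e, \<sigma>) \<in> reduced_database H D (e, \<sigma>)" if "e \<in> edges H" for e
    using u that by (auto simp: reduced_query_def)
  then have "\<forall>e\<in>edges H. \<exists>t\<in>D e. \<forall>X\<in>ends H e.
      (position \<sigma> X e < card (edges_at H X) \<longrightarrow>
        concat_upto (u (e, \<sigma>)) X (position \<sigma> X e) \<in> canonical_partition (interval_values H D X) (t X)) \<and>
      (position \<sigma> X e = card (edges_at H X) \<longrightarrow>
        concat_upto (u (e, \<sigma>)) X (position \<sigma> X e) = leaf_of (interval_values H D X) (t X))"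
    by (simp add: reduced_database_def Let_def)
  \<comment> \<open>\<open>t e\<close> is one original tuple witnessing the chosen reduced tuple of
    \<open>e\<close> at all its vertices simultaneously.\<close>
  then obtain t where t: "\<And>e. e \<in> edges H \<Longrightarrow> t e \<in> D e"
    and inner: "\<And>e X. \<lbrakk>e \<in> edges H; X \<in> ends H e; position \<sigma> X e < card (edges_at H X)\<rbrakk> \<Longrightarrow>
        concat_upto (u (e, \<sigma>)) X (position \<sigma> X e) \<in> canonical_partition (interval_values H D X) (t e X)"
    and last: "\<And>e X. \<lbrakk>e \<in> edges H; X \<in> ends H e; position \<sigma> X e = card (edges_at H X)\<rbrakk> \<Longrightarrow>
        concat_upto (u (e, \<sigma>)) X (position \<sigma> X e) = leaf_of (interval_values H D X) (t e X)"
    by metis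
  have "(\<Inter>e\<in>edges_at H X. set_of (t e X)) \<noteq> {}" if X: "X \<in> verts H" for X
  proof (cases "edges_at H X = {}")
    case False
    let ?I = "interval_values H D X"
    let ?k = "card (edges_at H X)"
    have fin: "finite (edges_at H X)" using H by (simp add: hypergraph_def edges_at_def)
    have "\<sigma> X \<in> permutations_of_set (edges_at H X)" using \<sigma> X by (auto simp: choices_def)
    then have perm: "distinct (\<sigma> X)" "set (\<sigma> X) = edges_at H X"
      by (auto simp: permutations_of_set_def)
    then have len: "length (\<sigma> X) = ?k" by (metis distinct_card)
    have k: "1 \<le> ?k" using fin False by (simp add: Suc_le_eq card_gt_0_iff)
    \<comment> \<open>The hyperedge in last position: its bitstrings at \<open>X\<close> spell a
      full path to a leaf, and the left endpoint of its interval will be the common point.\<close>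
    define a where "a = \<sigma> X ! (?k - 1)"
    have a: "a \<in> edges_at H X" unfolding a_def using perm len k nth_mem[of "?k - 1" "\<sigma> X"] by simp
    have pos: "position \<sigma> X a = ?k"
      unfolding a_def using position_nth[of \<sigma> X ?k, OF perm(1)] len k by simp
    define w where "w = leaf_of ?I (t a X)"
    have path: "concat_upto (u (a, \<sigma>)) X ?k = w"
      using last[of a X] a pos by (simp add: w_def edges_at_def)
    have lower: "lower (t a X) \<in> seg ?I w"
      unfolding w_def by (rule leaf_of(2)[OF finite_interval_values[OF H D]])
    have "lower (t a X) \<in> set_of (t e X)" if e: "e \<in> edges_at H X" for e
    proof (cases "e = a")
      case True
      then show ?thesis by (simp add: set_of_eq)
    next
      case False
      let ?i = "position \<sigma> X e"
      have i: "?i \<in> {1..?k}" "\<sigma> X ! (?i - 1) = e" using position_of_choice[OF \<sigma> H e] by auto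
      then have less: "?i < ?k" using False by (cases "?i = ?k") (auto simp: a_def)
      \<comment> \<open>The reduced hyperedge of \<open>a\<close> contains every point variable of
        \<open>X\<close>, so the equality joins make the bitstrings of \<open>e\<close> the first
        \<open>?i\<close> bitstrings of \<open>a\<close>.\<close>
      have "concat_upto (u (e, \<sigma>)) X ?i = concat_upto (u (a, \<sigma>)) X ?i"
      proof (rule concat_upto_cong, rule eq)
        fix j
        assume j: "j \<in> {1..?i}"
        then show "(X, j) \<in> verts (reduced_query H \<sigma>)" using X i by (simp add: reduced_query_def)
        show "(e, \<sigma>) \<in> edges_at (reduced_query H \<sigma>) (X, j)"
          using e j by (simp add: edges_at_reduced_query)
        show "(a, \<sigma>) \<in> edges_at (reduced_query H \<sigma>) (X, j)"
          using a j less by (simp add: edges_at_reduced_query pos)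
      qed
      \<comment> \<open>Splitting the index list exhibits the node of \<open>e\<close> as an
        ancestor of the leaf \<open>w\<close>, whose segment is therefore the smaller one.\<close>
      moreover have "[1..<Suc ?k] = [1..<Suc ?i] @ [Suc ?i..<Suc ?k]"
        using less upt_add_eq_append[of 1 "Suc ?i" "?k - ?i"] by simp
      then have "prefix (concat_upto (u (a, \<sigma>)) X ?i) w"
        unfolding path[symmetric] concat_upto_def by (simp del: upt_Suc)
      ultimately have "seg ?I w \<subseteq> seg ?I (concat_upto (u (e, \<sigma>)) X ?i)" by (simp add: seg_antimono)
      also have "\<dots> \<subseteq> set_of (t e X)"
        using inner[of e X] e less by (intro canonical_partition_seg) (simp add: edges_at_def)
      finally show ?thesis using lower by blast
    qed
    then show ?thesis by blast
  qed simp
  moreover have "restrict t (edges H) \<in> (\<Pi>\<^sub>E e\<in>edges H. D e)" using t by simp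
  moreover have "restrict t (edges H) e X = t e X" if "e \<in> edges_at H X" for e X
    using that by (simp add: edges_at_def)
  ultimately show ?thesis unfolding ij_true_def by (intro bexI[of _ "restrict t (edges H)"]) auto
qed

theorem theorem4p13:
  fixes H :: "('v, 'e) hypergraph"
    and D :: "('e, 'v, real interval) database"
  assumes "hypergraph H"
    and "database_over H D"
  shows "ij_true H D \<longleftrightarrow> (\<exists>Q \<in> reduced_queries H. ej_true Q (reduced_database H D))"
  using ij_true_imp_reduced[OF assms] reduced_imp_ij_true[OF assms]
  by (auto simp: reduced_queries_def)

end
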